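(* For every submodular stochastic depletion problem, for all $\bar s\in\mathcal S$ and all $\alpha\in\prod_{m=1}^M\{0,1,\dots,x(\bar s)_m\}$, $$J^*(\bar s)\le w\big(\bar x-x(\bar s)+\alpha\big)-w\big(\bar x-x(\bar s)\big)+J^*\big(\tilde S_\alpha(\bar s)\big).$$
   Context: Submodular stochastic depletion problem (clairvoyant form). There are $M$ item types, with at most $\bar x_m\in\mathbb Z_+$ items of type $m$, $\bar x=(\bar x_1,\dots,\bar x_M)$; a finite nonempty set $\mathcal A$ of activities; a horizon $T$ (a positive integer); and, for each $A\in\mathcal A$, a fixed known sequence $P_t(A)=(P_{t,1}(A),\dots,P_{t,M}(A))\in[0,1]^M$, $t=0,1,2,\dots$. The state space is $\mathcal S=\{(x,t): x\in\prod_{m}\{0,\dots,\bar x_m\},\ t\in\{0,\dots,T\}\}$; for $s=(x,t)$ write $x(s)=x$, $t(s)=t$. Vector inequalities are componentwise. If activity $A$ is used in state $s=(x,t)$ with $t<T$, a random vector $X_t=(X_{t,m})_m$ of items is depleted, where the $X_{t,m}$ are independent of each other and (given $x$ and $P_t(A)$) of the past, and $X_{t,m}\sim\mathrm{Binomial}(x_m,P_{t,m}(A))$. The next state is $(x-X_t,t+1)$ and the reward earned is $R(s,A)=w(\bar x-x+X_t)-w(\bar x-x)$, where $w:\mathbb Z_+^M\to\mathbb R$ satisfies: (monotonicity) $w(y)\ge w(y')$ whenever $y\ge y'$; (submodularity) for $e\in\mathbb Z_+^M$, $w(y+e)-w(y)\le w(y'+e)-w(y')$ whenever $y\ge y'$.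 A policy is a map $\pi:\mathcal S\to\mathcal A$; $J^\pi(s)=E\big[\sum_{t'=t(s)}^{T-1}R(S_{t'},\pi(S_{t'}))\mid S_{t(s)}=s\big]$, where $S_t$ is the state at time $t$ under $\pi$, and $J^*(s)=\max_\pi J^\pi(s)$. For $\alpha\in\mathbb Z_+^M$, $\tilde S_\alpha(s)$ is the state $s'$ with $t(s')=t(s)$ and $x(s')_m=\max(x(s)_m-\alpha_m,0)$ for all $m$. *)

theory Defs
  imports "HOL-Probability.Probability" "HOL-Probability.Product_PMF"
    "HOL-Library.Function_Algebras"
begin

text \<open>
  Item types are the elements of a finite type \<open>'m\<close>, and a vector of \<open>\<int>\<^sub>+\<^sup>M\<close> is a function
  \<open>'m \<Rightarrow> nat\<close>; addition, subtraction and order of such functions are componentwise.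
  Componentwise subtraction truncates at zero. In the capacity minus the remaining items, and in
  the remaining items minus the depleted ones, no truncation occurs on the state space (up to
  null events).
\<close>

type_synonym 'm state = "('m \<Rightarrow> nat) \<times> nat"

record ('m, 'a) depletion_problem =
  capacity :: "'m \<Rightarrow> nat"
  activities :: "'a set"
  horizon :: nat
  depl_prob :: "nat \<Rightarrow> 'a \<Rightarrow> 'm \<Rightarrow> real"
  item_value :: "('m \<Rightarrow> nat) \<Rightarrow> real"

definition submodular_fun :: "(('m \<Rightarrow> nat) \<Rightarrow> real) \<Rightarrow> bool" where
  "submodular_fun w \<longleftrightarrow> (\<forall>y y' e. y' \<le> y \<longrightarrow> w (y + e) - w y \<le> w (y' + e) - w y')"

definition submodular_depletion_problem :: "('m :: finite, 'a) depletion_problem \<Rightarrow> bool" where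
  "submodular_depletion_problem D \<longleftrightarrow>
     finite (activities D) \<and> activities D \<noteq> {} \<and>
     horizon D > 0 \<and>
     (\<forall>t. \<forall>A \<in> activities D. \<forall>m. depl_prob D t A m \<in> {0..1}) \<and>
     mono (item_value D) \<and> submodular_fun (item_value D)"

definition states :: "('m :: finite, 'a) depletion_problem \<Rightarrow> 'm state set" where
  "states D = {(x, t). x \<le> capacity D \<and> t \<le> horizon D}"

definition depletion_pmf ::
  "('m :: finite, 'a) depletion_problem \<Rightarrow> 'm state \<Rightarrow> 'a \<Rightarrow> ('m \<Rightarrow> nat) pmf" where
  "depletion_pmf D s A =
     Pi_pmf UNIV 0 (\<lambda>m. binomial_pmf (fst s m) (depl_prob D (snd s) A m))"

definition next_state :: "'m state \<Rightarrow> ('m \<Rightarrow> nat) \<Rightarrow> 'm state" where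
  "next_state s X = (fst s - X, snd s + 1)"

text \<open>The reward as a function of the state and the realised depletion \<open>X\<close>.\<close>

definition reward ::
  "('m :: finite, 'a) depletion_problem \<Rightarrow> 'm state \<Rightarrow> ('m \<Rightarrow> nat) \<Rightarrow> real" where
  "reward D s X =
     item_value D (capacity D - fst s + X) - item_value D (capacity D - fst s)"

definition policies :: "('m :: finite, 'a) depletion_problem \<Rightarrow> ('m state \<Rightarrow> 'a) set" where
  "policies D = states D \<rightarrow>\<^sub>E activities D"

text \<open>
  The joint law of the first \<open>n\<close> pairs (state, depletion) visited under the policy \<open>\<pi>\<close> when the
  process starts in state \<open>s\<close> at time \<open>snd s\<close>.
\<close>

primrec trajectory_pmf ::
  "('m :: finite, 'a) depletion_problem \<Rightarrow> ('m state \<Rightarrow> 'a) \<Rightarrow> nat \<Rightarrow> 'm state \<Rightarrow>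
     ('m state \<times> ('m \<Rightarrow> nat)) list pmf" where
  "trajectory_pmf D \<pi> 0 s = return_pmf []"
| "trajectory_pmf D \<pi> (Suc n) s =
     bind_pmf (depletion_pmf D s (\<pi> s))
       (\<lambda>X. map_pmf (\<lambda>h. (s, X) # h) (trajectory_pmf D \<pi> n (next_state s X)))"

definition policy_value ::
  "('m :: finite, 'a) depletion_problem \<Rightarrow> ('m state \<Rightarrow> 'a) \<Rightarrow> 'm state \<Rightarrow> real" where
  "policy_value D \<pi> s =
     measure_pmf.expectation (trajectory_pmf D \<pi> (horizon D - snd s) s)
       (\<lambda>h. \<Sum>(s', X)\<leftarrow>h. reward D s' X)"

definition opt_value :: "('m :: finite, 'a) depletion_problem \<Rightarrow> 'm state \<Rightarrow> real" where
  "opt_value D s = Max ((\<lambda>\<pi>. policy_value D \<pi> s) ` policies D)"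

definition removed_state :: "('m \<Rightarrow> nat) \<Rightarrow> 'm state \<Rightarrow> 'm state" where
  "removed_state \<alpha> s = (fst s - \<alpha>, snd s)"

end

theory Submission
  imports Defs
begin

text \<open>
  Rewards telescope: the total reward from a state \<open>x\<close> is the value of what is depleted at the
  horizon minus the value of what is depleted at \<open>x\<close>. The inequality therefore says that an optimal
  controller does not lose, measured by the final depleted set, when the items \<open>\<alpha>\<close> are handed
  over for free at the start.

  By the Bellman equation (\<open>opt_value_eq_bellman\<close>) this can be shown by induction on the number of
  remaining steps. For one step under a fixed activity, couple the two systems: by
  \<open>depletion_pmf_split\<close>, the depletion from \<open>x\<close> is \<open>X + Y\<close>, with \<open>X\<close> the depletion
  from \<open>x - \<alpha>\<close> and \<open>Y\<close> an independent depletion from \<open>\<alpha>\<close>. After the step, the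
  state of the first system dominates the state of the second one by exactly \<open>\<alpha> - Y\<close>, so the
  induction hypothesis applies with \<open>\<alpha> - Y\<close>, and the values of \<open>item_value\<close> cancel exactly.
  With no step remaining, the claim is monotonicity of \<open>item_value\<close>.
\<close>


section \<open>Splitting a depletion into independent parts\<close>

lemma binomial_pmf_add:
  assumes "p \<in> {0..1}"
  shows "binomial_pmf (j + k) p =
           bind_pmf (binomial_pmf j p) (\<lambda>X. bind_pmf (binomial_pmf k p) (\<lambda>Y. return_pmf (X + Y)))"
proof (induction j)
  case 0
  then show ?case
    using assms by (simp add: binomial_pmf_0 bind_return_pmf bind_return_pmf')
next
  case (Suc j)
  then show ?case
    using assms by (simp add: binomial_pmf_Suc bind_assoc_pmf bind_return_pmf add.assoc)
qed

lemma submodular_depletion_problem_prob: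
  "submodular_depletion_problem D \<Longrightarrow> A \<in> activities D \<Longrightarrow> depl_prob D t A m \<in> {0..1}"
  by (auto simp: submodular_depletion_problem_def)

text \<open>
  Additivity of the binomial distribution, applied to each item type: the items in \<open>x - \<alpha>\<close> and
  those in \<open>\<alpha>\<close> are depleted independently of each other.
\<close>

lemma depletion_pmf_split:
  assumes "submodular_depletion_problem D" "A \<in> activities D" "\<alpha> \<le> x"
  shows "depletion_pmf D (x, t) A =
           bind_pmf (depletion_pmf D (x - \<alpha>, t) A)
             (\<lambda>X. bind_pmf (depletion_pmf D (\<alpha>, t) A) (\<lambda>Y. return_pmf (X + Y)))"
proof -
  let ?b = "\<lambda>k m. binomial_pmf k (depl_prob D t A m)"
  have "x m = (x m - \<alpha> m) + \<alpha> m" for m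
    using assms(3) by (simp add: le_fun_def)
  then have "?b (x m) m = bind_pmf (?b (x m - \<alpha> m) m)
      (\<lambda>X. bind_pmf (?b (\<alpha> m) m) (\<lambda>Y. return_pmf (X + Y)))" for m
    using binomial_pmf_add[OF submodular_depletion_problem_prob[OF assms(1,2)], of "x m - \<alpha> m"]
    by metis
  then have "depletion_pmf D (x, t) A = Pi_pmf UNIV 0 (\<lambda>m. bind_pmf (?b (x m - \<alpha> m) m)
      (\<lambda>X. bind_pmf (?b (\<alpha> m) m) (\<lambda>Y. return_pmf (X + Y))))"
    by (simp add: depletion_pmf_def)
  also have "\<dots> = bind_pmf (depletion_pmf D (x - \<alpha>, t) A)
      (\<lambda>X. bind_pmf (depletion_pmf D (\<alpha>, t) A) (\<lambda>Y. return_pmf (X + Y)))"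
    by (simp add: depletion_pmf_def Pi_pmf_bind[where d' = 0] Pi_pmf_return_pmf plus_fun_def)
  finally show ?thesis .
qed


section \<open>Expectations over finitely supported distributions\<close>

lemma expectation_bind_pmf_finite:
  fixes h :: "'b \<Rightarrow> real"
  assumes "finite (set_pmf p)" "\<And>x. x \<in> set_pmf p \<Longrightarrow> finite (set_pmf (f x))"
  shows "measure_pmf.expectation (bind_pmf p f) h =
           measure_pmf.expectation p (\<lambda>x. measure_pmf.expectation (f x) h)"
proof -
  have "measure_pmf.expectation (bind_pmf p f) h =
          (\<Sum>a\<in>set_pmf p. pmf p a *\<^sub>R measure_pmf.expectation (f a) h)"
    by (rule pmf_expectation_bind) (use assms in auto)
  also have "\<dots> = measure_pmf.expectation p (\<lambda>x. measure_pmf.expectation (f x) h)"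
    by (rule integral_measure_pmf[symmetric]) (use assms in auto)
  finally show ?thesis .
qed

lemma expectation_mono_pmf_finite:
  fixes f g :: "'b \<Rightarrow> real"
  assumes "finite (set_pmf p)" "\<And>x. x \<in> set_pmf p \<Longrightarrow> f x \<le> g x"
  shows "measure_pmf.expectation p f \<le> measure_pmf.expectation p g"
  using assms by (intro integral_mono_AE integrable_measure_pmf_finite AE_pmfI) auto

lemma le_of_mem_set_depletion_pmf:
  assumes "submodular_depletion_problem D" "A \<in> activities D"
    and "X \<in> set_pmf (depletion_pmf D s A)"
  shows "X \<le> fst s"
proof (rule le_funI)
  fix m
  have "X m \<in> set_pmf (binomial_pmf (fst s m) (depl_prob D (snd s) A m))"
    using assms(3) by (auto simp: depletion_pmf_def set_Pi_pmf PiE_dflt_def)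
  then show "X m \<le> fst s m"
    using submodular_depletion_problem_prob[OF assms(1,2)]
    by (auto simp: set_pmf_binomial_eq split: if_splits)
qed

lemma finite_le_fun: "finite {y :: 'm :: finite \<Rightarrow> nat. y \<le> x}"
proof -
  have "{y. y \<le> x} = (\<Pi>\<^sub>E m\<in>UNIV. {..x m})"
    by (auto simp: le_fun_def PiE_def)
  then show ?thesis
    by (simp add: finite_PiE)
qed

lemma finite_set_depletion_pmf:
  assumes "submodular_depletion_problem D" "A \<in> activities D"
  shows "finite (set_pmf (depletion_pmf D s A))"
  by (rule finite_subset[OF _ finite_le_fun[of "fst s"]])
    (auto dest: le_of_mem_set_depletion_pmf[OF assms])


section \<open>The Bellman equation\<close>

text \<open>
  The expected value of using activity \<open>A\<close> in state \<open>s\<close> when the continuation from the next state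
  is worth \<open>v\<close>.
\<close>

definition action_value ::
  "('m :: finite, 'a) depletion_problem \<Rightarrow> ('m state \<Rightarrow> real) \<Rightarrow> 'm state \<Rightarrow> 'a \<Rightarrow> real" where
  "action_value D v s A =
     measure_pmf.expectation (depletion_pmf D s A) (\<lambda>X. reward D s X + v (next_state s X))"

text \<open>
  The value function of dynamic programming, indexed by the number of remaining steps. This number
  is not tied to the time in the state; the two agree where \<open>n = horizon D - snd s\<close>.
\<close>

primrec bellman :: "('m :: finite, 'a) depletion_problem \<Rightarrow> nat \<Rightarrow> 'm state \<Rightarrow> real" where
  "bellman D 0 s = 0"
| "bellman D (Suc n) s = Max (action_value D (bellman D n) s ` activities D)"

text \<open>
  The expected reward of the policy \<open>\<pi>\<close> over the next \<open>n\<close> steps. It is \<open>policy_value\<close> for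
  \<open>n = horizon D - snd s\<close>, and leaves \<open>n\<close> free for induction.
\<close>

definition steps_value ::
  "('m :: finite, 'a) depletion_problem \<Rightarrow> ('m state \<Rightarrow> 'a) \<Rightarrow> nat \<Rightarrow> 'm state \<Rightarrow> real" where
  "steps_value D \<pi> n s =
     measure_pmf.expectation (trajectory_pmf D \<pi> n s) (\<lambda>h. \<Sum>(s', X)\<leftarrow>h. reward D s' X)"

lemma action_value_mono:
  assumes "submodular_depletion_problem D" "A \<in> activities D"
    and "\<And>X. X \<le> fst s \<Longrightarrow> v (next_state s X) \<le> v' (next_state s X)"
  shows "action_value D v s A \<le> action_value D v' s A"
  unfolding action_value_def
  by (intro expectation_mono_pmf_finite finite_set_depletion_pmf assms(1,2) add_left_mono assms(3))
    (rule le_of_mem_set_depletion_pmf[OF assms(1,2)])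

lemma next_state_mem_states:
  assumes "s \<in> states D" "snd s < horizon D"
  shows "next_state s X \<in> states D"
proof -
  have "fst s m - X m \<le> capacity D m" for m
    using assms(1) by (auto simp: states_def le_fun_def intro: order_trans[OF diff_le_self])
  then show ?thesis
    using assms(2) by (auto simp: states_def next_state_def le_fun_def)
qed

lemma policies_apply: "\<pi> \<in> policies D \<Longrightarrow> s \<in> states D \<Longrightarrow> \<pi> s \<in> activities D"
  by (auto simp: policies_def)

lemma finite_set_trajectory_pmf:
  assumes "submodular_depletion_problem D" "\<pi> \<in> policies D"
  shows "s \<in> states D \<Longrightarrow> snd s + n \<le> horizon D \<Longrightarrow> finite (set_pmf (trajectory_pmf D \<pi> n s))"
proof (induction n arbitrary: s)
  case 0
  then show ?case by simp
next
  case (Suc n)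
  have "finite (set_pmf (trajectory_pmf D \<pi> n (next_state s X)))" for X
    using Suc.prems by (intro Suc.IH next_state_mem_states) (auto simp: next_state_def)
  moreover have "finite (set_pmf (depletion_pmf D s (\<pi> s)))"
    using Suc.prems assms by (intro finite_set_depletion_pmf policies_apply)
  ultimately show ?case
    by simp
qed

lemma steps_value_0 [simp]: "steps_value D \<pi> 0 s = 0"
  by (simp add: steps_value_def)

lemma steps_value_Suc:
  assumes "submodular_depletion_problem D" "\<pi> \<in> policies D" "s \<in> states D"
    and "snd s + Suc n \<le> horizon D"
  shows "steps_value D \<pi> (Suc n) s = action_value D (steps_value D \<pi> n) s (\<pi> s)"
proof -
  have fin: "finite (set_pmf (trajectory_pmf D \<pi> n (next_state s X)))" for X
    using assms by (intro finite_set_trajectory_pmf next_state_mem_states) (auto simp: next_state_def)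
  have fin': "finite (set_pmf (depletion_pmf D s (\<pi> s)))"
    using assms by (intro finite_set_depletion_pmf policies_apply)
  show ?thesis
    unfolding steps_value_def action_value_def trajectory_pmf.simps
    using fin fin'
    by (simp add: expectation_bind_pmf_finite integrable_measure_pmf_finite)
qed

lemma finite_activities: "submodular_depletion_problem D \<Longrightarrow> finite (activities D)"
  and activities_nonempty: "submodular_depletion_problem D \<Longrightarrow> activities D \<noteq> {}"
  by (auto simp: submodular_depletion_problem_def)

lemma steps_value_le_bellman:
  assumes "submodular_depletion_problem D" "\<pi> \<in> policies D"
  shows "s \<in> states D \<Longrightarrow> snd s + n \<le> horizon D \<Longrightarrow> steps_value D \<pi> n s \<le> bellman D n s"
proof (induction n arbitrary: s)
  case 0
  then show ?case by simp
next
  case (Suc n)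
  have A: "\<pi> s \<in> activities D"
    using Suc.prems assms by (intro policies_apply)
  have "steps_value D \<pi> (Suc n) s = action_value D (steps_value D \<pi> n) s (\<pi> s)"
    using assms Suc.prems by (rule steps_value_Suc)
  also have "\<dots> \<le> action_value D (bellman D n) s (\<pi> s)"
    using Suc.prems
    by (intro action_value_mono assms A Suc.IH next_state_mem_states) (auto simp: next_state_def)
  also have "\<dots> \<le> bellman D (Suc n) s"
    using A finite_activities[OF assms(1)] by simp
  finally show ?case .
qed

text \<open>A policy that is greedy for \<open>bellman\<close> attains the Bellman value from every state.\<close>

lemma exists_policy_bellman_le:
  assumes "submodular_depletion_problem D"
  obtains \<pi> where "\<pi> \<in> policies D"
    and "\<And>n s. s \<in> states D \<Longrightarrow> snd s + n = horizon D \<Longrightarrow> bellman D n s \<le> steps_value D \<pi> n s"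
proof -
  have "\<exists>A\<in>activities D. action_value D v s A = Max (action_value D v s ` activities D)" for v s
  proof -
    have "Max (action_value D v s ` activities D) \<in> action_value D v s ` activities D"
      using finite_activities[OF assms] activities_nonempty[OF assms] by (intro Max_in) auto
    then show ?thesis
      by (metis imageE)
  qed
  then obtain g where g: "g v s \<in> activities D"
      "action_value D v s (g v s) = Max (action_value D v s ` activities D)" for v s
    by metis
  \<comment> \<open>In a state at time \<open>t\<close>, there are \<open>horizon D - t - 1\<close> steps left after the current one.\<close>
  define \<pi> where "\<pi> = restrict (\<lambda>s. g (bellman D (horizon D - snd s - 1)) s) (states D)"
  have \<pi>: "\<pi> \<in> policies D"
    using g(1) by (auto simp: \<pi>_def policies_def)
  have "bellman D n s \<le> steps_value D \<pi> n s" if "s \<in> states D" "snd s + n = horizon D" for n s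
    using that
  proof (induction n arbitrary: s)
    case 0
    then show ?case by simp
  next
    case (Suc n)
    have "horizon D - snd s - 1 = n"
      using Suc.prems(2) by simp
    then have "\<pi> s = g (bellman D n) s"
      using Suc.prems(1) by (simp add: \<pi>_def)
    then have "bellman D (Suc n) s = action_value D (bellman D n) s (\<pi> s)"
      using g(2) by simp
    also have "\<dots> \<le> action_value D (steps_value D \<pi> n) s (\<pi> s)"
      using Suc.prems
      by (intro action_value_mono assms policies_apply[OF \<pi>] Suc.IH next_state_mem_states)
        (auto simp: next_state_def)
    also have "\<dots> = steps_value D \<pi> (Suc n) s"
      using Suc.prems by (intro steps_value_Suc[symmetric] assms \<pi>) auto
    finally show ?case .
  qed
  with \<pi> show thesis
    by (rule that)
qed

lemma finite_policies:
  assumes "submodular_depletion_problem D"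
  shows "finite (policies D)"
proof -
  have "states D = {x. x \<le> capacity D} \<times> {..horizon D}"
    by (auto simp: states_def)
  then show ?thesis
    unfolding policies_def using finite_activities[OF assms]
    by (simp add: finite_PiE finite_le_fun)
qed

lemma opt_value_eq_bellman:
  assumes "submodular_depletion_problem D" "s \<in> states D"
  shows "opt_value D s = bellman D (horizon D - snd s) s"
proof -
  have t: "snd s + (horizon D - snd s) = horizon D"
    using assms(2) by (auto simp: states_def)
  have pv: "policy_value D \<pi> s = steps_value D \<pi> (horizon D - snd s) s" for \<pi>
    by (simp add: policy_value_def steps_value_def)
  obtain \<pi> where \<pi>: "\<pi> \<in> policies D"
    and ge: "bellman D (horizon D - snd s) s \<le> policy_value D \<pi> s"
    using exists_policy_bellman_le[OF assms(1)] assms(2) t pv by metis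
  have le: "policy_value D \<rho> s \<le> bellman D (horizon D - snd s) s" if "\<rho> \<in> policies D" for \<rho>
    using steps_value_le_bellman[OF assms(1) that assms(2)] t pv by simp
  show ?thesis
    unfolding opt_value_def
  proof (rule Max_eqI)
    show "bellman D (horizon D - snd s) s \<in> (\<lambda>\<pi>. policy_value D \<pi> s) ` policies D"
      using \<pi> ge le[OF \<pi>] by force
  qed (use le finite_policies[OF assms(1)] in auto)
qed


section \<open>The cost of removing items\<close>

text \<open>
  The induction needs all \<open>x\<close> and \<open>\<alpha>\<close> at once, because the coupled step turns \<open>\<alpha>\<close> into the
  random vector \<open>\<alpha> - Y\<close>.
\<close>

lemma bellman_removal:
  fixes x \<alpha> :: "'m :: finite \<Rightarrow> nat"
  assumes D: "submodular_depletion_problem D"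
  shows "x \<le> capacity D \<Longrightarrow> \<alpha> \<le> x \<Longrightarrow>
    bellman D n (x, t) \<le> item_value D (capacity D - x + \<alpha>) - item_value D (capacity D - x)
      + bellman D n (x - \<alpha>, t)"
proof (induction n arbitrary: x \<alpha> t)
  case 0
  have "item_value D (capacity D - x) \<le> item_value D (capacity D - x + \<alpha>)"
    using D by (intro monoD[where f = "item_value D"])
      (auto simp: submodular_depletion_problem_def le_fun_def)
  then show ?case
    unfolding bellman.simps by linarith
next
  case (Suc n)
  define w c where "w = item_value D" and "c = capacity D"
  define V where "V y = bellman D n (y, Suc t)" for y
  let ?C = "w (c - x + \<alpha>) - w (c - x)"
  have av: "action_value D (bellman D n) (y, t) A =
      measure_pmf.expectation (depletion_pmf D (y, t) A)
        (\<lambda>X. w (c - y + X) - w (c - y) + V (y - X))" for y A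
    by (simp add: action_value_def reward_def next_state_def w_def c_def V_def)
  \<comment> \<open>The inequality holds for each outcome \<open>X\<close>, \<open>Y\<close> of the coupled depletions.\<close>
  have coupled: "w (c - x + (X + Y)) - w (c - x) + V (x - (X + Y)) \<le>
      ?C + (w (c - (x - \<alpha>) + X) - w (c - (x - \<alpha>)) + V (x - \<alpha> - X))"
    if "X \<le> x - \<alpha>" "Y \<le> \<alpha>" for X Y
  proof -
    have pt: "x m \<le> c m" "\<alpha> m \<le> x m" "X m \<le> x m - \<alpha> m" "Y m \<le> \<alpha> m" for m
      using Suc.prems that by (auto simp: le_fun_def c_def)
    have "x - (X + Y) \<le> c"
      unfolding le_fun_def
    proof
      fix m
      show "(x - (X + Y)) m \<le> c m"
        using pt(1)[of m] by simp
    qed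
    moreover have "\<alpha> - Y \<le> x - (X + Y)"
      unfolding le_fun_def
    proof
      fix m
      show "(\<alpha> - Y) m \<le> (x - (X + Y)) m"
        using pt[of m] by simp
    qed
    \<comment> \<open>After the step, \<open>\<alpha> - Y\<close> is what the first system has and the second one does not.\<close>
    ultimately have IH: "V (x - (X + Y)) \<le> w (c - (x - (X + Y)) + (\<alpha> - Y))
        - w (c - (x - (X + Y))) + V (x - (X + Y) - (\<alpha> - Y))"
      unfolding V_def w_def c_def by (rule Suc.IH)
    have "c - (x - (X + Y)) = c - x + (X + Y)"
    proof
      fix m
      show "(c - (x - (X + Y))) m = (c - x + (X + Y)) m"
        using pt[of m] by simp
    qed
    moreover have "c - x + (X + Y) + (\<alpha> - Y) = c - (x - \<alpha>) + X"
    proof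
      fix m
      show "(c - x + (X + Y) + (\<alpha> - Y)) m = (c - (x - \<alpha>) + X) m"
        using pt[of m] by simp
    qed
    moreover have "x - (X + Y) - (\<alpha> - Y) = x - \<alpha> - X"
    proof
      fix m
      show "(x - (X + Y) - (\<alpha> - Y)) m = (x - \<alpha> - X) m"
        using pt[of m] by simp
    qed
    moreover have "c - (x - \<alpha>) = c - x + \<alpha>"
    proof
      fix m
      show "(c - (x - \<alpha>)) m = (c - x + \<alpha>) m"
        using pt[of m] by simp
    qed
    ultimately show ?thesis
      using IH by simp
  qed
  have step: "action_value D (bellman D n) (x, t) A \<le> ?C + bellman D (Suc n) (x - \<alpha>, t)"
    if A: "A \<in> activities D" for A
  proof -
    note fin = finite_set_depletion_pmf[OF D A]
    let ?E = "\<lambda>y. measure_pmf.expectation (depletion_pmf D (y, t) A)"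
    have "action_value D (bellman D n) (x, t) A =
        ?E (x - \<alpha>) (\<lambda>X. ?E \<alpha> (\<lambda>Y. w (c - x + (X + Y)) - w (c - x) + V (x - (X + Y))))"
      unfolding av depletion_pmf_split[OF D A Suc.prems(2)]
      by (simp add: expectation_bind_pmf_finite fin)
    also have "\<dots> \<le> ?E (x - \<alpha>) (\<lambda>X. ?E \<alpha>
        (\<lambda>Y. ?C + (w (c - (x - \<alpha>) + X) - w (c - (x - \<alpha>)) + V (x - \<alpha> - X))))"
      using le_of_mem_set_depletion_pmf[OF D A]
      by (intro expectation_mono_pmf_finite fin coupled) fastforce+
    \<comment> \<open>The integrand no longer depends on \<open>Y\<close>.\<close>
    also have "\<dots> = ?C + action_value D (bellman D n) (x - \<alpha>, t) A"
      unfolding av by (simp add: integrable_measure_pmf_finite fin)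
    also have "\<dots> \<le> ?C + bellman D (Suc n) (x - \<alpha>, t)"
      using A finite_activities[OF D] by (intro add_left_mono) simp
    finally show ?thesis .
  qed
  have "bellman D (Suc n) (x, t) \<le> ?C + bellman D (Suc n) (x - \<alpha>, t)"
    unfolding bellman.simps(2)[of D n "(x, t)"]
    using finite_activities[OF D] activities_nonempty[OF D] step by (intro Max.boundedI) auto
  then show ?case
    unfolding w_def c_def .
qed

theorem lemma1:
  fixes D :: "('m :: finite, 'a) depletion_problem"
    and s :: "'m state"
    and \<alpha> :: "'m \<Rightarrow> nat"
  assumes "submodular_depletion_problem D"
    and "s \<in> states D"
    and "\<forall>m. \<alpha> m \<in> {0..fst s m}"
  shows "opt_value D s \<le>
           item_value D (capacity D - fst s + \<alpha>) - item_value D (capacity D - fst s)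
           + opt_value D (removed_state \<alpha> s)"
proof -
  obtain x t where s: "s = (x, t)"
    by (cases s)
  have x: "x \<le> capacity D" "t \<le> horizon D" and \<alpha>: "\<alpha> \<le> x"
    using assms(2,3) by (auto simp: s states_def le_fun_def)
  have "x m - \<alpha> m \<le> capacity D m" for m
    using x(1) by (auto simp: le_fun_def intro: order_trans[OF diff_le_self])
  then have "(x - \<alpha>, t) \<in> states D"
    using x(2) by (simp add: states_def le_fun_def)
  then show ?thesis
    using bellman_removal[OF assms(1) x(1) \<alpha>] opt_value_eq_bellman[OF assms(1)] assms(2)
    by (simp add: s removed_state_def)
qed

end
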